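(* Let $R$ be an integral domain, with $G^\ast$, $M$ as defined in the context. Let $I^\sim$ be the set of all ideals of $R$ ordered by inverse inclusion ($a\leqslant b$ in $I^\sim$ iff $a\supseteq b$), and let $M$ be ordered by inclusion. Define $g:I^\sim\to M$ by $g(a)=\{[x]\in G^\ast\mid (x)\supseteq a\}$ for each ideal $a$ of $R$, and $d:M\to I^\sim$ by $d(J)=\bigcap_{[x]\in J}(x)$ for each $J\in M$. Then $(g,d)$ is a Galois connection between $I^\sim$ and $M$; that is, $g$ and $d$ are isotone and, for all $J\in M$ and all ideals $a$ of $R$, $J\subseteq g(a)$ if and only if $d(J)\leqslant a$ in $I^\sim$.
   Context: $R$ is an integral domain (commutative ring with $1\neq 0$, no zero divisors), $R^\ast=R\setminus\{0\}$, $U$ is the group of units of $R$, and $G^\ast=R^\ast/U$ is the ordered monoid of classes $[x]$ ($x\in R^\ast$), with $[x][y]=[xy]$ and $[x]\leqslant[y]$ iff $x$ divides $y$ in $R$. $(x)$ denotes the principal ideal generated by $x$. For $a\in G^\ast$, $\downarrow a=\{c\in G^\ast\mid c\leqslant a\}$, and for $A\subseteq G^\ast$, $\downarrow A=\bigcup_{a\in A}\downarrow a$. $B=\{[p]^n\mid p\in R \text{ prime},\ n=1,2,\dots\}$. A nonempty subset $J\subseteq G^\ast$ is a $B$-ideal if $\downarrow J=J$ and, for each $a\in G^\ast$, whenever $\downarrow a\cap B\subseteq J$ and the supremum $\bigvee(\downarrow a\cap B)$ exists in $G^\ast$, then $\bigvee(\downarrow a\cap B)\in J$. $M$ is the collection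 of all $B$-ideals. Galois connection: for posets $P_1,P_2$ and isotone maps $d:P_1\to P_2$, $g:P_2\to P_1$, the pair $(g,d)$ is a Galois connection between $P_2$ and $P_1$ if $x\leqslant g(y)$ is equivalent to $d(x)\leqslant y$ for all $x\in P_1$, $y\in P_2$. *)

theory Defs
  imports "HOL-Algebra.Ring_Divisibility" "HOL-Algebra.Galois_Connection"
begin

section \<open>The ordered monoid of classes of nonzero elements modulo units\<close>

definition nonzeros :: "('a, 'm) ring_scheme \<Rightarrow> 'a set" where
  "nonzeros R = carrier R - {\<zero>\<^bsub>R\<^esub>}"

definition unit_class :: "('a, 'm) ring_scheme \<Rightarrow> 'a \<Rightarrow> 'a set" where
  "unit_class R x = x <#\<^bsub>R\<^esub> Units R"

text \<open>
  The product of two classes is their setwise product, as for quotient groups in HOL-Algebra;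
  \<open>unit_class_mult\<close> below shows that it is the class of the product of representatives.
\<close>

definition Gstar :: "('a, 'm) ring_scheme \<Rightarrow> 'a set monoid" where
  "Gstar R = \<lparr>carrier = unit_class R ` nonzeros R, mult = set_mult R, one = unit_class R \<one>\<^bsub>R\<^esub>\<rparr>"

text \<open>
  The order does not depend on the representatives, see \<open>unit_class_le_iff\<close> below.
\<close>

definition Gstar_order :: "('a, 'm) ring_scheme \<Rightarrow> 'a set gorder" where
  "Gstar_order R =
    \<lparr>carrier = carrier (Gstar R),
     eq = (=),
     le = (\<lambda>a b. \<exists>x\<in>nonzeros R. \<exists>y\<in>nonzeros R.
       a = unit_class R x \<and> b = unit_class R y \<and> x divides\<^bsub>R\<^esub> y)\<rparr>"

context domain
begin

lemma unit_class_eq_iff: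
  assumes "x \<in> nonzeros R" "y \<in> nonzeros R"
  shows "unit_class R x = unit_class R y \<longleftrightarrow> x \<sim> y"
proof
  assume eq: "unit_class R x = unit_class R y"
  have "x \<in> unit_class R x" "y \<in> unit_class R y"
    using assms by (auto simp: unit_class_def l_coset_def nonzeros_def intro!: bexI[of _ \<one>])
  then have "x \<in> unit_class R y" "y \<in> unit_class R x"
    using eq by auto
  then show "x \<sim> y"
    by (auto simp: unit_class_def l_coset_def associated_def factor_def)
next
  assume "x \<sim> y"
  then obtain u where u: "u \<in> Units R" "x = y \<otimes> u"
    using ring_associated_iff[of x y] assms m_comm by (auto simp: nonzeros_def)
  have y: "y \<in> carrier R" using assms by (simp add: nonzeros_def)
  have "\<exists>w\<in>Units R. y \<otimes> v = y \<otimes> u \<otimes> w" if v: "v \<in> Units R" for v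
  proof
    show "inv u \<otimes> v \<in> Units R" using u v by simp
    have "y \<otimes> u \<otimes> (inv u \<otimes> v) = y \<otimes> (u \<otimes> inv u) \<otimes> v"
      using u v y by (simp add: m_assoc Units_closed del: Units_r_inv)
    then show "y \<otimes> v = y \<otimes> u \<otimes> (inv u \<otimes> v)"
      using u y by simp
  qed
  moreover have "\<exists>w\<in>Units R. y \<otimes> u \<otimes> v = y \<otimes> w" if v: "v \<in> Units R" for v
    using u v y by (intro bexI[of _ "u \<otimes> v"]) (auto simp: m_assoc Units_closed)
  ultimately show "unit_class R x = unit_class R y"
    unfolding unit_class_def l_coset_def u(2) by auto
qed

lemma unit_class_mult:
  assumes "x \<in> nonzeros R" "y \<in> nonzeros R"
  shows "unit_class R x \<otimes>\<^bsub>Gstar R\<^esub> unit_class R y = unit_class R (x \<otimes> y)"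
proof -
  have xy: "x \<in> carrier R" "y \<in> carrier R" using assms by (auto simp: nonzeros_def)
  have 1: "(x \<otimes> u) \<otimes> (y \<otimes> v) = (x \<otimes> y) \<otimes> (u \<otimes> v)" if "u \<in> Units R" "v \<in> Units R" for u v
    using that xy by (simp add: m_ac Units_closed)
  have "\<exists>v\<in>Units R. \<exists>w\<in>Units R. (x \<otimes> y) \<otimes> u = (x \<otimes> v) \<otimes> (y \<otimes> w)" if "u \<in> Units R" for u
    using 1[OF that, of \<one>] that xy
    by (intro bexI[of _ u] bexI[of _ \<one>]) (auto simp: Units_closed)
  with 1 show ?thesis
    by (auto simp: Gstar_def unit_class_def l_coset_def set_mult_def)
qed

lemma unit_class_pow:
  assumes "x \<in> nonzeros R"
  shows "unit_class R x [^]\<^bsub>Gstar R\<^esub> (n::nat) = unit_class R (x [^] n)"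
proof (induction n)
  case 0
  show ?case by (simp add: nat_pow_def) (simp add: Gstar_def)
next
  case (Suc n)
  have "x [^] n \<in> nonzeros R"
    using assms by (induction n) (auto simp: nonzeros_def integral_iff)
  then show ?case
    using Suc unit_class_mult[OF _ assms] by (simp add: nat_pow_def)
qed

lemma unit_class_le_iff:
  assumes "x \<in> nonzeros R" "y \<in> nonzeros R"
  shows "unit_class R x \<sqsubseteq>\<^bsub>Gstar_order R\<^esub> unit_class R y \<longleftrightarrow> x divides y"
proof
  assume "unit_class R x \<sqsubseteq>\<^bsub>Gstar_order R\<^esub> unit_class R y"
  then obtain x' y' where "x' \<in> nonzeros R" "y' \<in> nonzeros R" "x \<sim> x'" "y \<sim> y'" "x' divides y'"
    using assms by (auto simp: Gstar_order_def unit_class_eq_iff)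
  then show "x divides y"
    using assms unfolding associated_def nonzeros_def
    by (meson DiffD1 divides_trans)
qed (use assms in \<open>auto simp: Gstar_order_def\<close>)

lemma Gstar_partial_order: "partial_order (Gstar_order R)"
proof -
  have car: "carrier (Gstar_order R) = unit_class R ` nonzeros R"
    by (simp add: Gstar_order_def Gstar_def)
  have eq: "(.=\<^bsub>Gstar_order R\<^esub>) = (=)"
    by (simp add: Gstar_order_def)
  have refl: "a \<sqsubseteq>\<^bsub>Gstar_order R\<^esub> a" if "a \<in> carrier (Gstar_order R)" for a
    using that by (auto simp: car unit_class_le_iff) (simp add: nonzeros_def)
  have antisym: "a = b"
    if ab: "a \<sqsubseteq>\<^bsub>Gstar_order R\<^esub> b" "b \<sqsubseteq>\<^bsub>Gstar_order R\<^esub> a"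
      and c: "a \<in> carrier (Gstar_order R)" "b \<in> carrier (Gstar_order R)" for a b
  proof -
    obtain x y where xy: "x \<in> nonzeros R" "y \<in> nonzeros R" "a = unit_class R x" "b = unit_class R y"
      using c unfolding car by blast
    then have "x \<sim> y"
      using ab by (simp add: unit_class_le_iff associated_def)
    then show ?thesis
      unfolding xy(3,4) unit_class_eq_iff[OF xy(1,2)] .
  qed
  have trans: "a \<sqsubseteq>\<^bsub>Gstar_order R\<^esub> c"
    if ab: "a \<sqsubseteq>\<^bsub>Gstar_order R\<^esub> b" "b \<sqsubseteq>\<^bsub>Gstar_order R\<^esub> c"
      and c: "a \<in> carrier (Gstar_order R)" "b \<in> carrier (Gstar_order R)" "c \<in> carrier (Gstar_order R)"
    for a b c
  proof -
    obtain x y z where xyz: "x \<in> nonzeros R" "y \<in> nonzeros R" "z \<in> nonzeros R"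
      "a = unit_class R x" "b = unit_class R y" "c = unit_class R z"
      using c unfolding car by blast
    then have "x divides y" "y divides z" "x \<in> carrier R"
      using ab by (simp_all add: unit_class_le_iff) (simp add: nonzeros_def)
    then have "x divides z" by (rule divides_trans)
    then show ?thesis using xyz by (simp add: unit_class_le_iff)
  qed
  have "weak_partial_order (Gstar_order R)"
  proof
    show "a \<sqsubseteq>\<^bsub>Gstar_order R\<^esub> c"
      if "a \<sqsubseteq>\<^bsub>Gstar_order R\<^esub> b" "b \<sqsubseteq>\<^bsub>Gstar_order R\<^esub> c" "a \<in> carrier (Gstar_order R)"
        "b \<in> carrier (Gstar_order R)" "c \<in> carrier (Gstar_order R)" for a b c
      using that by (rule trans)
    show "a .=\<^bsub>Gstar_order R\<^esub> b"
      if "a \<sqsubseteq>\<^bsub>Gstar_order R\<^esub> b" "b \<sqsubseteq>\<^bsub>Gstar_order R\<^esub> a" "a \<in> carrier (Gstar_order R)"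
        "b \<in> carrier (Gstar_order R)" for a b
      using antisym[OF that] by (simp add: eq)
  qed (auto simp: eq refl)
  then show ?thesis
    by (intro partial_order.intro partial_order_axioms.intro) (simp_all add: eq)
qed

end


section \<open>\<open>B\<close>-ideals\<close>

definition down :: "('a, 'm) ring_scheme \<Rightarrow> 'a set \<Rightarrow> 'a set set" where
  "down R a = {c \<in> carrier (Gstar R). c \<sqsubseteq>\<^bsub>Gstar_order R\<^esub> a}"

definition down_set :: "('a, 'm) ring_scheme \<Rightarrow> 'a set set \<Rightarrow> 'a set set" where
  "down_set R A = (\<Union>a\<in>A. down R a)"

definition prime_powers :: "('a, 'm) ring_scheme \<Rightarrow> 'a set set" where
  "prime_powers R =
    {unit_class R p [^]\<^bsub>Gstar R\<^esub> n | p (n::nat). p \<in> carrier R \<and> ring_prime\<^bsub>R\<^esub> p \<and> n \<ge> 1}"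

definition has_sup :: "('a, 'm) gorder_scheme \<Rightarrow> 'a set \<Rightarrow> bool" where
  "has_sup L A \<longleftrightarrow> (\<exists>s. least L s (Upper L A))"

text \<open>
  The supremum may be taken over the empty set, when no prime divides \<open>a\<close>; it is then the class of
  the units.
\<close>

definition B_ideal :: "('a, 'm) ring_scheme \<Rightarrow> 'a set set \<Rightarrow> bool" where
  "B_ideal R J \<longleftrightarrow>
    J \<noteq> {} \<and> J \<subseteq> carrier (Gstar R) \<and> down_set R J = J \<and>
    (\<forall>a\<in>carrier (Gstar R).
      down R a \<inter> prime_powers R \<subseteq> J \<longrightarrow>
      has_sup (Gstar_order R) (down R a \<inter> prime_powers R) \<longrightarrow>
      \<Squnion>\<^bsub>Gstar_order R\<^esub> (down R a \<inter> prime_powers R) \<in> J)"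

definition B_ideals_order :: "('a, 'm) ring_scheme \<Rightarrow> 'a set set gorder" where
  "B_ideals_order R = \<lparr>carrier = {J. B_ideal R J}, eq = (=), le = (\<subseteq>)\<rparr>"


section \<open>Ideals under inverse inclusion, and the two maps\<close>

definition ideals_order :: "('a, 'm) ring_scheme \<Rightarrow> 'a set gorder" where
  "ideals_order R = \<lparr>carrier = {I. ideal I R}, eq = (=), le = (\<lambda>I K. I \<supseteq> K)\<rparr>"

definition g_map :: "('a, 'm) ring_scheme \<Rightarrow> 'a set \<Rightarrow> 'a set set" where
  "g_map R I = {unit_class R x | x. x \<in> nonzeros R \<and> PIdl\<^bsub>R\<^esub> x \<supseteq> I}"

definition d_map :: "('a, 'm) ring_scheme \<Rightarrow> 'a set set \<Rightarrow> 'a set" where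
  "d_map R J = (\<Inter>x\<in>{x \<in> nonzeros R. unit_class R x \<in> J}. PIdl\<^bsub>R\<^esub> x)"

end

theory Submission
  imports Defs
begin

text \<open>
  Everything rests on one reading of the upper map. Since \<open>I \<subseteq> (x)\<close> means that \<open>x\<close> divides every
  element of \<open>I\<close>, and since everything divides \<open>0\<close>, the set \<open>g(I)\<close> is exactly the set of lower bounds
  in \<open>G\<^sup>*\<close> of the classes \<open>[i]\<close> of the nonzero elements \<open>i\<close> of \<open>I\<close> (\<open>g_map_eq_Lower\<close>). A set of lower
  bounds, in any order, is closed downwards and under every supremum that happens to exist, because
  its defining bounds are upper bounds of each of its subsets; in particular it is closed under the
  suprema of sets of prime powers that occur in the definition of a \<open>B\<close>-ideal. It is nonempty
  because it contains the class of the units. Hence \<open>g(I)\<close> is a \<open>B\<close>-ideal. On the other side,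
  \<open>d(J)\<close> is an intersection of principal ideals, hence an ideal.

  The adjunction is then that of a polarity: both \<open>J \<subseteq> g(I)\<close> and \<open>I \<subseteq> d(J)\<close> say that \<open>I \<subseteq> (x)\<close> for all
  \<open>x\<close> with \<open>[x] \<in> J\<close>. Isotonicity of both maps is a formal consequence of the adjunction.
\<close>

text \<open>
  Each element of \<open>A\<close> is an upper bound of \<open>S\<close>, so the least upper bound lies below it.
\<close>

lemma sup_mem_Lower:
  assumes sub: "S \<subseteq> Lower L A" and sup: "has_sup L S"
  shows "\<Squnion>\<^bsub>L\<^esub> S \<in> Lower L A"
proof -
  have least: "least L (\<Squnion>\<^bsub>L\<^esub> S) (Upper L S)"
    using sup unfolding has_sup_def sup_def by (rule someI_ex)
  have "A \<inter> carrier L \<subseteq> Upper L S"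
    using sub by (auto simp: Upper_def Lower_def)
  then show ?thesis
    using least by (auto simp: least_def Lower_def Upper_def)
qed

context domain
begin

lemma carrier_Gstar_order: "carrier (Gstar_order R) = carrier (Gstar R)"
  by (simp add: Gstar_order_def)

lemma carrier_Gstar: "carrier (Gstar R) = unit_class R ` nonzeros R"
  by (simp add: Gstar_def)

lemma mem_PIdl_iff_divides:
  assumes "x \<in> carrier R" "y \<in> carrier R"
  shows "y \<in> PIdl x \<longleftrightarrow> x divides y"
  using assms by (auto simp: cgenideal_def factor_def m_comm)

text \<open>
  The zero element imposes no condition on the divisor, which is why it may be left out although
  it has no class in \<open>G\<^sup>*\<close>.
\<close>

lemma subset_PIdl_iff:
  assumes x: "x \<in> nonzeros R" and I: "I \<subseteq> carrier R"
  shows "I \<subseteq> PIdl x \<longleftrightarrow>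
    (\<forall>i\<in>I - {\<zero>}. unit_class R x \<sqsubseteq>\<^bsub>Gstar_order R\<^esub> unit_class R i)"
proof -
  have xc: "x \<in> carrier R"
    using x by (simp add: nonzeros_def)
  have "\<zero> \<in> PIdl x"
    using xc by (simp add: mem_PIdl_iff_divides divides_zero)
  then have "I \<subseteq> PIdl x \<longleftrightarrow> (\<forall>i\<in>I - {\<zero>}. i \<in> PIdl x)"
    by auto
  also have "\<dots> \<longleftrightarrow> (\<forall>i\<in>I - {\<zero>}. unit_class R x \<sqsubseteq>\<^bsub>Gstar_order R\<^esub> unit_class R i)"
  proof (rule ball_cong[OF refl])
    fix i assume "i \<in> I - {\<zero>}"
    then have "i \<in> nonzeros R" "i \<in> carrier R"
      using I by (auto simp: nonzeros_def)
    then show "i \<in> PIdl x \<longleftrightarrow> unit_class R x \<sqsubseteq>\<^bsub>Gstar_order R\<^esub> unit_class R i"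
      using x xc by (simp add: mem_PIdl_iff_divides unit_class_le_iff)
  qed
  finally show ?thesis .
qed

lemma g_map_eq_Lower:
  assumes I: "I \<subseteq> carrier R"
  shows "g_map R I = Lower (Gstar_order R) (unit_class R ` (I - {\<zero>}))"
proof -
  have "unit_class R ` (I - {\<zero>}) \<inter> carrier (Gstar_order R) = unit_class R ` (I - {\<zero>})"
    using I by (auto simp: carrier_Gstar_order carrier_Gstar nonzeros_def)
  then have "Lower (Gstar_order R) (unit_class R ` (I - {\<zero>})) =
      {c \<in> carrier (Gstar R). \<forall>i\<in>I - {\<zero>}. c \<sqsubseteq>\<^bsub>Gstar_order R\<^esub> unit_class R i}"
    by (auto simp: Lower_def carrier_Gstar_order)
  also have "\<dots> = unit_class R ` {x \<in> nonzeros R. I \<subseteq> PIdl x}"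
    using I by (auto simp: carrier_Gstar subset_PIdl_iff)
  also have "\<dots> = g_map R I"
    by (auto simp: g_map_def)
  finally show ?thesis by simp
qed

text \<open>
  The inclusion \<open>I \<subseteq> (x)\<close> depends only on the class of \<open>x\<close>, so it can be tested on any
  representative.
\<close>

lemma unit_class_mem_g_map_iff:
  assumes "x \<in> nonzeros R" "I \<subseteq> carrier R"
  shows "unit_class R x \<in> g_map R I \<longleftrightarrow> I \<subseteq> PIdl x"
proof
  assume "unit_class R x \<in> g_map R I"
  then obtain y where "y \<in> nonzeros R" "unit_class R x = unit_class R y" "I \<subseteq> PIdl y"
    by (auto simp: g_map_def)
  then show "I \<subseteq> PIdl x"
    using assms by (simp add: subset_PIdl_iff)
qed (use assms in \<open>auto simp: g_map_def\<close>)

text \<open>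
  Transitivity gives closure downwards, and \<open>sup_mem_Lower\<close> gives closure under all existing
  suprema, those of sets of prime powers among them.
\<close>

lemma B_ideal_Lower:
  assumes A: "A \<subseteq> carrier (Gstar_order R)" and ne: "Lower (Gstar_order R) A \<noteq> {}"
  shows "B_ideal R (Lower (Gstar_order R) A)"
proof -
  interpret partial_order "Gstar_order R"
    by (rule Gstar_partial_order)
  let ?J = "Lower (Gstar_order R) A"
  have "down_set R ?J \<subseteq> ?J"
    using A by (auto simp: down_set_def down_def Lower_def carrier_Gstar_order intro: le_trans)
  moreover have "?J \<subseteq> down_set R ?J"
    by (auto simp: down_set_def down_def Lower_def carrier_Gstar_order)
  ultimately have "down_set R ?J = ?J"
    by (rule subset_antisym)
  moreover have "?J \<subseteq> carrier (Gstar R)"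
    by (auto simp: Lower_def carrier_Gstar_order)
  ultimately show ?thesis
    using ne by (auto simp: B_ideal_def sup_mem_Lower)
qed

lemma B_ideal_g_map:
  assumes I: "I \<subseteq> carrier R"
  shows "B_ideal R (g_map R I)"
proof -
  have one: "\<one> \<in> nonzeros R"
    by (simp add: nonzeros_def)
  have "I \<subseteq> PIdl \<one>"
    using I mem_PIdl_iff_divides[OF one_closed] one_divides by blast
  then have "unit_class R \<one> \<in> g_map R I"
    using one I by (simp add: unit_class_mem_g_map_iff)
  moreover have "unit_class R ` (I - {\<zero>}) \<subseteq> carrier (Gstar_order R)"
    using I by (auto simp: carrier_Gstar_order carrier_Gstar nonzeros_def)
  ultimately show ?thesis
    unfolding g_map_eq_Lower[OF I] by (intro B_ideal_Lower) auto
qed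

text \<open>
  Without an element of \<open>J\<close> the intersection would run over no ideals at all and be the whole
  type instead of a subset of the ring.
\<close>

lemma ideal_d_map:
  assumes "J \<subseteq> carrier (Gstar R)" "J \<noteq> {}"
  shows "ideal (d_map R J) R"
  unfolding d_map_def
proof (rule i_Intersect)
  show "(\<lambda>x. PIdl x) ` {x \<in> nonzeros R. unit_class R x \<in> J} \<noteq> {}"
    using assms by (auto simp: carrier_Gstar)
qed (auto simp: nonzeros_def intro: cgenideal_ideal)

lemma subset_d_map_iff:
  assumes J: "J \<subseteq> carrier (Gstar R)" and I: "I \<subseteq> carrier R"
  shows "I \<subseteq> d_map R J \<longleftrightarrow> J \<subseteq> g_map R I"
proof -
  have "I \<subseteq> d_map R J \<longleftrightarrow> (\<forall>x\<in>nonzeros R. unit_class R x \<in> J \<longrightarrow> I \<subseteq> PIdl x)"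
    by (auto simp: d_map_def)
  also have "\<dots> \<longleftrightarrow> (\<forall>x\<in>nonzeros R. unit_class R x \<in> J \<longrightarrow> unit_class R x \<in> g_map R I)"
    using I by (simp add: unit_class_mem_g_map_iff)
  also have "\<dots> \<longleftrightarrow> J \<subseteq> g_map R I"
    using J by (auto simp: carrier_Gstar)
  finally show ?thesis .
qed

end

lemma partial_order_B_ideals_order: "partial_order (B_ideals_order R)"
  by unfold_locales (auto simp: B_ideals_order_def)

lemma partial_order_ideals_order: "partial_order (ideals_order R)"
  by unfold_locales (auto simp: ideals_order_def)

theorem proposition3p1:
  fixes R :: "('a, 'm) ring_scheme"
  assumes "domain R"
  shows "galois_connection
           \<lparr>orderA = B_ideals_order R, orderB = ideals_order R, lower = d_map R, upper = g_map R\<rparr>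
         \<and> isotone (ideals_order R) (B_ideals_order R) (g_map R)
         \<and> isotone (B_ideals_order R) (ideals_order R) (d_map R)"
proof -
  interpret domain R by fact
  have sub: "I \<subseteq> carrier R" if "ideal I R" for I
    using additive_subgroup.a_subset[OF ideal.axioms(1)[OF that]] .
  have "galois_connection
      \<lparr>orderA = B_ideals_order R, orderB = ideals_order R, lower = d_map R, upper = g_map R\<rparr>"
    (is "galois_connection ?G")
  proof (intro galois_connection.intro connection.intro galois_connection_axioms.intro)
    show "lower ?G \<in> carrier (orderA ?G) \<rightarrow> carrier (orderB ?G)"
      by (auto simp: B_ideals_order_def ideals_order_def B_ideal_def intro!: ideal_d_map)
    show "upper ?G \<in> carrier (orderB ?G) \<rightarrow> carrier (orderA ?G)"
      by (auto simp: B_ideals_order_def ideals_order_def intro!: B_ideal_g_map dest: sub)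
    show "lower ?G J \<sqsubseteq>\<^bsub>orderB ?G\<^esub> I \<longleftrightarrow> J \<sqsubseteq>\<^bsub>orderA ?G\<^esub> upper ?G I"
      if "J \<in> carrier (orderA ?G)" "I \<in> carrier (orderB ?G)" for J I
    proof -
      have "J \<subseteq> carrier (Gstar R)" "I \<subseteq> carrier R"
        using that sub by (simp_all add: B_ideals_order_def ideals_order_def B_ideal_def)
      then show ?thesis
        using subset_d_map_iff by (simp add: B_ideals_order_def ideals_order_def)
    qed
  qed (simp_all add: partial_order_B_ideals_order partial_order_ideals_order)
  then show ?thesis
    using galois_connection.lower_iso galois_connection.upper_iso by fastforce
qed

end
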